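(* For every integer $n\ge0$, the modified Bernoulli numbers $B_{2n+1}^{*}$ are given by $$B_{2n+1}^{*}=\frac{(-1)^n}{4}+\frac12U_{2n}\left(\tfrac12\right)=\frac{(-1)^n}{4}+\frac{1}{\sqrt3}\sin\left(\frac{(2n+1)\pi}{3}\right).$$ In particular, the sequence $\{B_{2n+1}^{*}\}_{n\ge0}$ is periodic of period $6$.
   Context: The Bernoulli numbers $B_r$ are defined by $\frac{t}{e^t-1}=\sum_{r=0}^\infty B_r\frac{t^r}{r!}$ (so $B_1=-\tfrac12$). For an integer $n>0$ the modified Bernoulli number is $B_n^{*}=\sum_{r=0}^{n}\binom{n+r}{2r}\frac{B_r}{n+r}$. $U_m$ denotes the Chebyshev polynomial of the second kind, $U_m(\cos\theta)=\frac{\sin((m+1)\theta)}{\sin\theta}$. *)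

theory Defs
  imports Complex_Main "HOL-Computational_Algebra.Computational_Algebra"
begin

definition bernoulli :: "nat \<Rightarrow> real" where
  "bernoulli r = fact r * fps_nth (fps_X / (fps_exp 1 - 1)) r"

text \<open>The quotient of formal power series is exact, so it really is the generating function.\<close>

lemma bernoulli_egf:
  "Abs_fps (\<lambda>r. bernoulli r / fact r) * (fps_exp 1 - 1) = fps_X"
proof -
  let ?g = "fps_exp 1 - 1 :: real fps"
  have n1: "fps_nth ?g 1 = 1" and n0: "fps_nth ?g 0 = 0" by simp_all
  then have sd: "subdegree ?g = 1" by (intro subdegreeI) auto
  then have "?g \<noteq> 0" by auto
  then have "?g dvd fps_X" using sd by (simp add: fps_dvd_iff)
  then have "fps_X / ?g * ?g = fps_X" by simp
  moreover have "Abs_fps (\<lambda>r. bernoulli r / fact r) = fps_X / ?g"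
    by (rule fps_ext) (simp add: bernoulli_def)
  ultimately show ?thesis by simp
qed

text \<open>Meant for positive arguments only: at 0 it involves a division by zero.\<close>

definition modified_bernoulli :: "nat \<Rightarrow> real" where
  "modified_bernoulli n = (\<Sum>r=0..n. real ((n + r) choose (2 * r)) * (bernoulli r / real (n + r)))"

definition chebyshev_U :: "nat \<Rightarrow> real poly" where
  "chebyshev_U m = (THE p. \<forall>\<theta>. sin \<theta> \<noteq> 0 \<longrightarrow>
     poly p (cos \<theta>) = sin (real (m + 1) * \<theta>) / sin \<theta>)"

text \<open>The definite description is justified by existence (via the three-term recurrence) and
  uniqueness (a polynomial is determined by its values on the open interval from -1 to 1).\<close>

lemma chebyshev_U_exists:
  "\<exists>p. \<forall>\<theta>. sin \<theta> \<noteq> 0 \<longrightarrow> poly p (cos \<theta>) = sin (real (m + 1) * \<theta>) / sin \<theta>"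
proof (induction m rule: less_induct)
  case (less m)
  consider "m = 0" | "m = 1" | k where "m = Suc (Suc k)"
    by (metis One_nat_def not0_implies_Suc)
  then show ?case
  proof cases
    case 1
    then show ?thesis by (intro exI[of _ 1]) simp
  next
    case 2
    then show ?thesis by (intro exI[of _ "[:0, 2:]"]) (simp add: sin_double)
  next
    case 3
    from less[of k] 3 obtain p where p:
      "\<And>\<theta>. sin \<theta> \<noteq> 0 \<Longrightarrow> poly p (cos \<theta>) = sin (real (k + 1) * \<theta>) / sin \<theta>" by auto
    from less[of "Suc k"] 3 obtain q where q:
      "\<And>\<theta>. sin \<theta> \<noteq> 0 \<Longrightarrow> poly q (cos \<theta>) = sin (real (k + 2) * \<theta>) / sin \<theta>" by auto
    have "poly ([:0, 2:] * q - p) (cos \<theta>) = sin (real (m + 1) * \<theta>) / sin \<theta>"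
      if "sin \<theta> \<noteq> 0" for \<theta>
    proof -
      have a: "real (m + 1) * \<theta> = real (k + 2) * \<theta> + \<theta>"
        and b: "real (k + 1) * \<theta> = real (k + 2) * \<theta> - \<theta>"
        using 3 by (simp_all add: algebra_simps)
      show ?thesis
        unfolding poly_diff poly_mult p[OF that] q[OF that] a b sin_add sin_diff
        using that by (simp add: field_simps)
    qed
    then show ?thesis by blast
  qed
qed

lemma chebyshev_U_cos:
  assumes "sin \<theta> \<noteq> 0"
  shows "poly (chebyshev_U m) (cos \<theta>) = sin (real (m + 1) * \<theta>) / sin \<theta>"
proof -
  let ?P = "\<lambda>p. \<forall>\<theta>. sin \<theta> \<noteq> 0 \<longrightarrow> poly p (cos \<theta>) = sin (real (m + 1) * \<theta>) / sin \<theta>"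
  have "p = q" if p: "?P p" and q: "?P q" for p q
  proof (rule ccontr)
    assume "p \<noteq> q"
    then have fin: "finite {x. poly (p - q) x = 0}" by (intro poly_roots_finite) simp
    have "{-1<..<1} \<subseteq> {x. poly (p - q) x = 0}"
    proof safe
      fix x :: real assume x: "x \<in> {-1<..<1}"
      then have "cos (arccos x) = x" by simp
      moreover have "sin (arccos x) \<noteq> 0" using x by (intro sin_arccos_nonzero) auto
      ultimately show "poly (p - q) x = 0" using p q by (metis diff_self poly_diff)
    qed
    with fin have "finite {-1<..<1::real}" by (rule finite_subset[rotated])
    then show False using infinite_Ioo[of "-1" "1::real"] by simp
  qed
  then have "\<exists>!p. ?P p" using chebyshev_U_exists[of m] by blast
  from theI'[OF this] show ?thesis using assms unfolding chebyshev_U_def by blast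
qed

end

(* Let L be the linear functional on polynomials with L(x^r) = B_r. Then n B*_n = L(p), where
   p(x) = T_n(1 + x/2), and the generating function of the Bernoulli numbers gives
   L(p(x+1)) = L(p) + p'(0) = L(p(-x)). For odd n the symmetry T_n(-y) = -T_n(y) becomes
   p(-4-x) = -p(x), so
     -L(p) = L(p(-4-x)) = L(p(x-3)) = L(p) - p'(-3) - p'(-2) - p'(-1),
   and since T_n' = n U_{n-1}, the derivatives are values of U_{n-1} at -1/2, 0, 1/2. *)

theory Submission
  imports Defs
begin

section \<open>The linear functional on polynomials taking x^r to the r-th Bernoulli number\<close>

definition bernoulli_functional :: "real poly \<Rightarrow> real" where
  "bernoulli_functional p = (\<Sum>i\<le>degree p. coeff p i * bernoulli i)"

text \<open>Padding the sum beyond the degree allows polynomials of different degrees to share one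
  summation range, which linearity needs.\<close>

lemma bernoulli_functional_eq_sum:
  assumes "degree p \<le> N"
  shows "bernoulli_functional p = (\<Sum>i\<le>N. coeff p i * bernoulli i)"
  unfolding bernoulli_functional_def
  by (rule sum.mono_neutral_left) (use assms in \<open>auto simp: coeff_eq_0\<close>)

lemma bernoulli_functional_add:
  "bernoulli_functional (p + q) = bernoulli_functional p + bernoulli_functional q"
proof -
  let ?N = "max (degree p) (degree q)"
  show ?thesis
    using degree_add_le_max[of p q]
    by (simp add: bernoulli_functional_eq_sum[of _ ?N] sum.distrib algebra_simps)
qed

lemma bernoulli_functional_smult:
  "bernoulli_functional (smult c p) = c * bernoulli_functional p"
  by (simp add: bernoulli_functional_eq_sum[of _ "degree p"] sum_distrib_left mult.assoc)

lemma bernoulli_functional_uminus: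
  "bernoulli_functional (- p) = - bernoulli_functional p"
  using bernoulli_functional_smult[of "-1" p] by simp

lemma bernoulli_functional_sum:
  "bernoulli_functional (sum f A) = (\<Sum>i\<in>A. bernoulli_functional (f i))"
proof (induction A rule: infinite_finite_induct)
  case (insert x A)
  then show ?case by (simp add: bernoulli_functional_add)
qed (simp_all add: bernoulli_functional_def)

lemma bernoulli_functional_monom: "bernoulli_functional (monom c n) = c * bernoulli n"
proof -
  have "bernoulli_functional (monom c n) = (\<Sum>i\<le>n. if i = n then c * bernoulli n else 0)"
    unfolding bernoulli_functional_eq_sum[OF degree_monom_le[of c n]] by (intro sum.cong) auto
  then show ?thesis by simp
qed

lemma pcompose_monom: "pcompose (monom c n) q = smult c (q ^ n)"
  by (induction n) (simp_all add: monom_0 monom_Suc pcompose_pCons)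

text \<open>Reduces any substitution to powers of the inner polynomial, where identities for single
  Bernoulli numbers apply.\<close>

lemma bernoulli_functional_pcompose:
  "bernoulli_functional (pcompose p q) = (\<Sum>i\<le>degree p. coeff p i * bernoulli_functional (q ^ i))"
proof -
  have "pcompose p q = (\<Sum>i\<le>degree p. smult (coeff p i) (q ^ i))"
    by (subst poly_as_sum_of_monoms[symmetric]) (simp only: pcompose_sum pcompose_monom)
  then show ?thesis
    by (simp add: bernoulli_functional_sum bernoulli_functional_smult)
qed

section \<open>Translation and reflection under the functional\<close>

lemma bernoulli_egf_exp:
  "Abs_fps (\<lambda>r. bernoulli r / fact r) * fps_exp 1 = Abs_fps (\<lambda>r. bernoulli r / fact r) + fps_X"
  using bernoulli_egf by (simp add: algebra_simps)

text \<open>Compare coefficients of t^n in G(t) e^t = G(t) + t, where G is the exponential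
  generating function of the Bernoulli numbers.\<close>

lemma bernoulli_binomial_sum:
  "(\<Sum>k\<le>n. real (n choose k) * bernoulli k) = bernoulli n + (if n = 1 then 1 else 0)"
proof -
  have "bernoulli n / fact n + (if n = 1 then 1 else 0)
      = fps_nth (Abs_fps (\<lambda>r. bernoulli r / fact r) * fps_exp 1) n"
    by (simp add: bernoulli_egf_exp fps_X_def)
  also have "\<dots> = (\<Sum>k\<le>n. (bernoulli k / fact k) * (1 / fact (n - k)))"
    by (simp add: fps_mult_nth atLeast0AtMost)
  finally have "bernoulli n + fact n * (if n = 1 then 1 else 0)
      = fact n * (\<Sum>k\<le>n. (bernoulli k / fact k) * (1 / fact (n - k)))"
    by (auto simp: field_simps split: if_splits)
  also have "\<dots> = (\<Sum>k\<le>n. real (n choose k) * bernoulli k)"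
    unfolding sum_distrib_left
    by (intro sum.cong) (auto simp: binomial_fact field_simps)
  finally show ?thesis by (auto split: if_splits)
qed

text \<open>The generating function satisfies G(-t) = G(t) e^t = G(t) + t; compare coefficients.
  Here \<open>H\<close> is G(-t).\<close>

lemma bernoulli_reflect:
  "(- 1) ^ n * bernoulli n = bernoulli n + (if n = 1 then 1 else 0)"
proof -
  define G where "G = Abs_fps (\<lambda>r. bernoulli r / fact r)"
  define H where "H = fps_compose G (- fps_X)"
  have ge: "G * (fps_exp 1 - 1) = fps_X"
    unfolding G_def by (rule bernoulli_egf)
  have "fps_compose (G * (fps_exp 1 - 1)) (- fps_X) = - fps_X"
    unfolding ge by simp
  then have "H * (fps_exp (-1) - 1) = - fps_X"
    unfolding H_def
    by (simp add: fps_compose_mult_distrib fps_compose_sub_distrib flip: fps_exp_neg)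
  \<comment> \<open>The factor e^t turns e^(-t) - 1 into 1 - e^t, so that \<open>H\<close> and G e^t
    have the same product with e^t - 1, which can then be cancelled.\<close>
  then have "H * (fps_exp (-1) - 1) * fps_exp 1 = - fps_X * fps_exp 1" by simp
  moreover have "fps_exp (-1) * fps_exp 1 = (1 :: real fps)"
    by (simp flip: fps_exp_add_mult)
  ultimately have "H * (fps_exp 1 - 1) = G * fps_exp 1 * (fps_exp 1 - 1)"
    using ge by algebra
  moreover have "fps_exp 1 - 1 \<noteq> (0 :: real fps)" using ge by auto
  ultimately have "H = G * fps_exp 1" by simp
  then have "H = G + fps_X" unfolding G_def by (simp add: bernoulli_egf_exp)
  then have "fps_nth H n = fps_nth (G + fps_X) n" by simp
  moreover have "fps_nth H n = (- 1) ^ n * (bernoulli n / fact n)"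
    unfolding H_def G_def by (simp add: fps_compose_uminus')
  ultimately show ?thesis
    by (auto simp: G_def fps_X_def field_simps split: if_splits)
qed

lemma bernoulli_functional_power_shift:
  "bernoulli_functional ([:1, 1:] ^ n) = bernoulli n + (if n = 1 then 1 else 0)"
proof -
  have "[:1, 1:] ^ n = (\<Sum>k\<le>n. monom (real (n choose k)) k)"
  proof -
    have "[:1, 1 :: real:] = monom 1 1 + 1" by (simp add: monom_altdef one_pCons)
    then show ?thesis
      by (simp add: binomial_ring monom_power of_nat_monom mult_monom)
  qed
  then show ?thesis
    by (simp add: bernoulli_functional_sum bernoulli_functional_monom bernoulli_binomial_sum)
qed

lemma bernoulli_functional_power_reflect:
  "bernoulli_functional ([:0, - 1:] ^ n) = bernoulli n + (if n = 1 then 1 else 0)"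
proof -
  have "[:0, - 1 :: real:] ^ n = monom ((- 1) ^ n) n"
    using monom_power[of "- 1 :: real" 1 n] by (simp add: monom_altdef)
  then show ?thesis
    by (simp add: bernoulli_functional_monom bernoulli_reflect)
qed

text \<open>On powers the correction is 1 for exponent 1 and 0 otherwise. By linearity it adds up to
  the coefficient of x, which is p'(0).\<close>

lemma bernoulli_functional_shift:
  "bernoulli_functional (pcompose p [:1, 1:]) = bernoulli_functional p + poly (pderiv p) 0"
proof -
  have "(\<Sum>i\<le>degree p. coeff p i * (if i = 1 then 1 else 0)) = coeff p 1"
    by (cases "degree p = 0") (auto simp: coeff_eq_0 if_distrib sum.delta cong: if_cong)
  then show ?thesis
    unfolding bernoulli_functional_pcompose bernoulli_functional_power_shift
    by (simp add: bernoulli_functional_def distrib_left sum.distrib poly_0_coeff_0 coeff_pderiv)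
qed

text \<open>The substitutions -x and x + 1 give the same value on every power of x, hence on every
  polynomial.\<close>

lemma bernoulli_functional_reflect:
  "bernoulli_functional (pcompose p [:0, - 1:]) = bernoulli_functional (pcompose p [:1, 1:])"
  unfolding bernoulli_functional_pcompose bernoulli_functional_power_shift
    bernoulli_functional_power_reflect ..

text \<open>The unit shift applied to p(x + a), whose derivative at 0 is p'(a).\<close>

lemma bernoulli_functional_shift_Suc:
  "bernoulli_functional (pcompose p [:a + 1, 1:])
     = bernoulli_functional (pcompose p [:a, 1:]) + poly (pderiv p) a"
proof -
  have "pcompose p [:a + 1, 1:] = pcompose (pcompose p [:a, 1:]) [:1, 1:]"
    by (simp add: pcompose_pCons flip: pcompose_assoc)
  then show ?thesis
    by (simp add: bernoulli_functional_shift pderiv_pcompose poly_pcompose pderiv_pCons)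
qed

section \<open>Chebyshev polynomials of the first kind in the variable 1 + x/2\<close>

text \<open>\<^term>\<open>shifted_lucas n\<close> is the polynomial \<open>2 T\<^sub>n(1 + x/2)\<close>,
  with \<open>T\<^sub>n\<close> the Chebyshev polynomial of the first kind.\<close>

fun shifted_lucas :: "nat \<Rightarrow> real poly" where
  "shifted_lucas 0 = [:2:]"
| "shifted_lucas (Suc 0) = [:2, 1:]"
| "shifted_lucas (Suc (Suc n)) = [:2, 1:] * shifted_lucas (Suc n) - shifted_lucas n"

text \<open>Each of the two binomials satisfies the coefficient form of the three-term recurrence,
  by repeated use of Pascal's rule. The form as a sum avoids division in the induction.\<close>

lemma coeff_shifted_lucas_Suc:
  "coeff (shifted_lucas (Suc n)) r
     = real ((n + 1 + r) choose (2 * r)) + real ((n + r) choose (2 * r))"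
proof (induction n arbitrary: r rule: induct_nat_012)
  case 0
  then show ?case
    by (cases r; cases "r - 1") (auto simp: coeff_pCons binomial_eq_0 numeral_2_eq_2)
next
  case 1
  have "shifted_lucas 2 = [:2, 4, 1:]" by (simp add: numeral_2_eq_2)
  then show ?case
    by (cases r; cases "r - 1"; cases "r - 2")
      (auto simp: coeff_pCons binomial_eq_0 numeral_2_eq_2)
next
  case (ge2 n)
  then show ?case
    unfolding shifted_lucas.simps(3)[of "Suc n"]
    by (cases r) (simp_all add: coeff_pCons del: shifted_lucas.simps)
qed

text \<open>Absorption, (n - r) C(n+r, 2r) = (n + r) C(n+r-1, 2r), merges the two binomials into the
  weight of B_r in \<open>modified_bernoulli\<close>, up to the factor 2n. The case r > n is
  separate because the subtraction of naturals truncates; there both sides vanish.\<close>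

lemma coeff_shifted_lucas:
  assumes "n > 0"
  shows "coeff (shifted_lucas n) r
     = 2 * real n * (real ((n + r) choose (2 * r)) / real (n + r))"
proof (cases "r \<le> n")
  case True
  have "(n + r - 2 * r) * ((n + r) choose (2 * r)) = (n + r) * ((n + r - 1) choose (2 * r))"
    by (rule binomial_absorb_comp)
  then have "real (n + r - 2 * r) * real ((n + r) choose (2 * r))
      = real (n + r) * real ((n + r - 1) choose (2 * r))"
    by (simp only: flip: of_nat_mult)
  moreover have "real (n + r - 2 * r) = real n - real r" using True by simp
  ultimately show ?thesis
    using assms coeff_shifted_lucas_Suc[of "n - 1" r] by (simp add: field_simps)
next
  case False
  then show ?thesis
    using assms coeff_shifted_lucas_Suc[of "n - 1" r] by (simp add: binomial_eq_0)
qed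

lemma degree_shifted_lucas_le: "degree (shifted_lucas n) \<le> n"
proof (cases n)
  case (Suc m)
  then show ?thesis by (intro degree_le) (simp add: coeff_shifted_lucas_Suc binomial_eq_0)
qed simp

lemma modified_bernoulli_eq_functional:
  assumes "n > 0"
  shows "2 * real n * modified_bernoulli n = bernoulli_functional (shifted_lucas n)"
  using assms
  by (simp add: bernoulli_functional_eq_sum[OF degree_shifted_lucas_le] modified_bernoulli_def
      coeff_shifted_lucas sum_distrib_left atLeast0AtMost mult.assoc)

text \<open>The map x -> -4 - x negates y = 1 + x/2, so this is the parity of T_n. In the induction
  the factor x + 2 supplies the sign.\<close>

lemma shifted_lucas_reflect:
  "pcompose (shifted_lucas n) [:- 4, - 1:] = smult ((- 1) ^ n) (shifted_lucas n)"
proof (induction n rule: shifted_lucas.induct)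
  case (3 n)
  have "pcompose [:2, 1 :: real:] [:- 4, - 1:] = - [:2, 1:]" by (simp add: pcompose_pCons)
  then show ?case
    unfolding shifted_lucas.simps pcompose_diff pcompose_mult 3 by (simp add: smult_diff_right smult_add_right mult.commute)
qed (simp_all add: pcompose_pCons)

text \<open>At x = 2 cos \<theta> - 2 the variable 1 + x/2 is cos \<theta>, so this is T_n(cos
  \<theta>) = cos(n \<theta>), doubled.\<close>

lemma poly_shifted_lucas_cos: "poly (shifted_lucas n) (2 * cos \<theta> - 2) = 2 * cos (real n * \<theta>)"
proof (induction n rule: shifted_lucas.induct)
  case (3 n)
  have a: "real (Suc (Suc n)) * \<theta> = real (Suc n) * \<theta> + \<theta>"
    and b: "real n * \<theta> = real (Suc n) * \<theta> - \<theta>"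
    by (simp_all add: algebra_simps)
  show ?case
    using 3 unfolding shifted_lucas.simps poly_diff poly_mult a b cos_add cos_diff
    by (simp add: algebra_simps)
qed simp_all

text \<open>Differentiate the preceding identity in \<theta> on both sides. The result is n
  U_{n-1}(cos \<theta>) for n > 0.\<close>

lemma poly_pderiv_shifted_lucas_cos:
  assumes "sin \<theta> \<noteq> 0"
  shows "poly (pderiv (shifted_lucas n)) (2 * cos \<theta> - 2) = real n * sin (real n * \<theta>) / sin \<theta>"
proof -
  have "((\<lambda>t. poly (shifted_lucas n) (2 * cos t - 2)) has_real_derivative
      poly (pderiv (shifted_lucas n)) (2 * cos \<theta> - 2) * (- 2 * sin \<theta>)) (at \<theta>)"
    by (rule DERIV_chain2[OF poly_DERIV]) (auto intro!: derivative_eq_intros)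
  moreover have "((\<lambda>t. 2 * cos (real n * t)) has_real_derivative
      - 2 * real n * sin (real n * \<theta>)) (at \<theta>)"
    by (auto intro!: derivative_eq_intros)
  ultimately have "poly (pderiv (shifted_lucas n)) (2 * cos \<theta> - 2) * (- 2 * sin \<theta>)
      = - 2 * real n * sin (real n * \<theta>)"
    unfolding poly_shifted_lucas_cos by (rule DERIV_unique)
  then show ?thesis using assms by (simp add: field_simps)
qed

section \<open>Evaluation for odd index\<close>

lemma bernoulli_functional_antisymmetric:
  assumes "pcompose p [:- 4, - 1:] = - p"
  shows "2 * bernoulli_functional p
     = poly (pderiv p) (- 3) + poly (pderiv p) (- 2) + poly (pderiv p) (- 1)"
proof -
  \<comment> \<open>Reflection is applied to q(x) = p(x - 4): then q(-x) = p(-4 - x) and q(x + 1) =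
    p(x - 3).\<close>
  have "pcompose (pcompose p [:- 4, 1:]) [:0, - 1:] = - p"
    by (simp add: assms pcompose_pCons flip: pcompose_assoc)
  moreover have "pcompose (pcompose p [:- 4, 1:]) [:1, 1:] = pcompose p [:- 3, 1:]"
    by (simp add: pcompose_pCons flip: pcompose_assoc)
  ultimately have "- bernoulli_functional p = bernoulli_functional (pcompose p [:- 3, 1:])"
    using bernoulli_functional_reflect[of "pcompose p [:- 4, 1:]"]
    by (simp add: bernoulli_functional_uminus)
  \<comment> \<open>Three unit shifts lead from p(x - 3) back to p(x).\<close>
  moreover have "bernoulli_functional p
      = bernoulli_functional (pcompose p [:- 3, 1:])
        + poly (pderiv p) (- 3) + poly (pderiv p) (- 2) + poly (pderiv p) (- 1)"
    using bernoulli_functional_shift_Suc[of p "- 3"] bernoulli_functional_shift_Suc[of p "- 2"]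
      bernoulli_functional_shift_Suc[of p "- 1"] by simp
  ultimately show ?thesis by simp
qed

lemma poly_chebyshev_U_half:
  "poly (chebyshev_U m) (1 / 2) = 2 / sqrt 3 * sin (real (m + 1) * pi / 3)"
  using chebyshev_U_cos[of "pi / 3" m] by (simp add: cos_60 sin_60 field_simps)

text \<open>The points -1, -2, -3 are 2 cos \<theta> - 2 for \<theta> = pi/3, pi/2, 2 pi/3. The
  outer two contribute equally and give the sine term; the middle one gives the alternating
  sign.\<close>

lemma modified_bernoulli_odd:
  "modified_bernoulli (2 * n + 1)
     = (- 1) ^ n / 4 + 1 / sqrt 3 * sin (real (2 * n + 1) * pi / 3)"
proof -
  let ?m = "2 * n + 1"
  let ?p = "shifted_lucas ?m"
  let ?s = "sin (real ?m * pi / 3)"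
  have "poly (pderiv ?p) (- 1) = real ?m * (2 / sqrt 3 * ?s)"
    using poly_pderiv_shifted_lucas_cos[of "pi / 3" ?m] by (simp add: cos_60 sin_60)
  moreover have "poly (pderiv ?p) (- 2) = real ?m * (- 1) ^ n"
  proof -
    have "sin (real ?m * (pi / 2)) = (- 1) ^ n"
      using sin_cos_npi[of n] by (simp add: mult.commute)
    then show ?thesis using poly_pderiv_shifted_lucas_cos[of "pi / 2" ?m] by simp
  qed
  moreover have "poly (pderiv ?p) (- 3) = real ?m * (2 / sqrt 3 * ?s)"
  proof -
    \<comment> \<open>As \<open>?m\<close> is odd, sin(\<open>?m\<close> pi - a) = sin a, which
      reduces 2 pi/3 to pi/3.\<close>
    have "real ?m * (2 * pi / 3) = real ?m * pi - real ?m * pi / 3" by (simp add: field_simps)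
    then have "sin (real ?m * (2 * pi / 3)) = ?s"
      by (simp only: sin_diff sin_npi cos_npi) simp
    then show ?thesis
      using poly_pderiv_shifted_lucas_cos[of "2 * pi / 3" ?m] by (simp add: cos_120 sin_120)
  qed
  moreover have "4 * real ?m * modified_bernoulli ?m
      = poly (pderiv ?p) (- 3) + poly (pderiv ?p) (- 2) + poly (pderiv ?p) (- 1)"
    using bernoulli_functional_antisymmetric[of ?p] shifted_lucas_reflect[of ?m]
      modified_bernoulli_eq_functional[of ?m] by (simp add: algebra_simps)
  ultimately have "real ?m * (4 * modified_bernoulli ?m)
      = real ?m * (4 / sqrt 3 * ?s + (- 1) ^ n)"
    by (simp add: algebra_simps)
  then have "4 * modified_bernoulli ?m = 4 / sqrt 3 * ?s + (- 1) ^ n"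
    by (subst (asm) mult_cancel_left) simp
  then show ?thesis by simp
qed

section \<open>The exact period\<close>

lemma sin_odd_pi_third_periodic:
  "sin (real (2 * (n + 3) + 1) * pi / 3) = sin (real (2 * n + 1) * pi / 3)"
proof -
  have "real (2 * (n + 3) + 1) * pi / 3 = real (2 * n + 1) * pi / 3 + 2 * pi"
    by (simp add: field_simps)
  then show ?thesis by (simp only: sin_periodic)
qed

text \<open>Advancing n by 3 preserves the sine term and flips the sign of (-1)^n / 4. This serves
  both to prove period 6 and to exclude smaller ones.\<close>

lemma modified_bernoulli_odd_add_3:
  "modified_bernoulli (2 * (n + 3) + 1) = modified_bernoulli (2 * n + 1) - (- 1) ^ n / 2"
  unfolding modified_bernoulli_odd sin_odd_pi_third_periodic by (simp add: power_add)

lemma modified_bernoulli_1_3_5: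
  "modified_bernoulli 1 = 3 / 4" "modified_bernoulli 3 = - 1 / 4" "modified_bernoulli 5 = - 1 / 4"
proof -
  have "sin (5 * pi / 3) = - (sqrt 3 / 2)"
  proof -
    have "5 * pi / 3 = 2 * pi - pi / 3" by simp
    then show ?thesis by (simp only: sin_2pi_minus sin_60)
  qed
  then show "modified_bernoulli 1 = 3 / 4" "modified_bernoulli 3 = - 1 / 4"
    "modified_bernoulli 5 = - 1 / 4"
    using modified_bernoulli_odd[of 0] modified_bernoulli_odd[of 1] modified_bernoulli_odd[of 2]
    by (simp_all add: sin_60)
qed

theorem corollary10p6:
  shows "(\<forall>n::nat.
            modified_bernoulli (2 * n + 1) = (- 1) ^ n / 4 + 1 / 2 * poly (chebyshev_U (2 * n)) (1 / 2)
          \<and> (- 1) ^ n / 4 + 1 / 2 * poly (chebyshev_U (2 * n)) (1 / 2)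
              = (- 1) ^ n / 4 + 1 / sqrt 3 * sin (real (2 * n + 1) * pi / 3))
       \<and> (\<forall>n::nat. modified_bernoulli (2 * (n + 6) + 1) = modified_bernoulli (2 * n + 1))
       \<and> (\<forall>p::nat. 0 < p \<and> p < 6 \<longrightarrow>
            \<not> (\<forall>n::nat. modified_bernoulli (2 * (n + p) + 1) = modified_bernoulli (2 * n + 1)))"
proof (intro conjI allI impI)
  fix n :: nat
  show U: "(- 1) ^ n / 4 + 1 / 2 * poly (chebyshev_U (2 * n)) (1 / 2)
      = (- 1) ^ n / 4 + 1 / sqrt 3 * sin (real (2 * n + 1) * pi / 3)"
    by (simp add: poly_chebyshev_U_half)
  then show "modified_bernoulli (2 * n + 1)
      = (- 1) ^ n / 4 + 1 / 2 * poly (chebyshev_U (2 * n)) (1 / 2)"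
    by (simp only: modified_bernoulli_odd)
  \<comment> \<open>The corrections of two successive steps by 3 have opposite signs and
    cancel.\<close>
  show "modified_bernoulli (2 * (n + 6) + 1) = modified_bernoulli (2 * n + 1)"
    using modified_bernoulli_odd_add_3[of n] modified_bernoulli_odd_add_3[of "n + 3"]
    by (simp add: algebra_simps power_add)
next
  fix p :: nat
  assume "0 < p \<and> p < 6"
  then have "p \<in> {1, 2, 3, 4, 5}" by auto
  \<comment> \<open>It suffices to compare with n = 0: the value there is 3/4, while n = 1, ..., 5
    give -1/4, -1/4, 1/4, 1/4, -3/4.\<close>
  then have "modified_bernoulli (2 * p + 1) \<noteq> modified_bernoulli 1"
    using modified_bernoulli_odd_add_3[of 0] modified_bernoulli_odd_add_3[of 1]
      modified_bernoulli_odd_add_3[of 2]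
    by (auto simp: modified_bernoulli_1_3_5 simp flip: One_nat_def)
  then show "\<not> (\<forall>n. modified_bernoulli (2 * (n + p) + 1) = modified_bernoulli (2 * n + 1))"
    by (metis add_0 mult_0_right)
qed

end
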